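(* Let $\mathbf{d}:\Omega(gl(N))\otimes U(gl(N)_h)\to\Omega(gl(N))\otimes U(gl(N)_h)$ be the de Rham operator, i.e. the linear operator defined by $$\mathbf{d}(\omega\otimes a)=\sum_{i,j=1}^N \omega\, d_i^j\otimes\partial_j^i(a),\qquad \omega\in\Omega(gl(N)),\ a\in U(gl(N)_h),$$ where $\partial_j^i$ are the quantum partial derivatives on $U(gl(N)_h)$. Then $\mathbf{d}^2=0$.
   Context: The ground field is $\mathbb{C}$, and $h$ is a parameter. $U(gl(N)_h)$ is the unital associative algebra generated by $m_i^j$, $1\le i,j\le N$, subject to $[m_i^j,m_k^l]=h(\delta_k^j m_i^l-\delta_i^l m_k^j)$. Quantum partial derivatives: $\mathcal{D}$ is the commutative unital algebra generated by $\partial_i^j$, $1\le i,j\le N$. It is a bialgebra with coproduct $$\Delta(\partial_i^j)=\partial_i^j\otimes 1+1\otimes\partial_i^j+h\sum_{k=1}^N\partial_k^j\otimes\partial_i^k$$ and counit $\varepsilon(1)=1$, $\varepsilon(\partial_i^j)=0$. It acts linearly on $U(gl(N)_h)$ (the action is a representation of $\mathcal{D}$, with $1_{\mathcal D}$ acting as the identity) by $\partial_i^j(1)=0$, $\partial_i^j(m_k^l)=\delta_i^l\delta_k^j\,1$, and the quantum Leibniz rule $$\partial_i^j(ab)=\partial_i^j(a)\,b+a\,\partial_i^j(b)+h\sum_{k=1}^N\partial_k^j(a)\,\partial_i^k(b),\qquad a,b\in U(gl(N)_h).$$ $\Omega(gl(N))$ is the skew-symmetric (exterior) algebra generated by the $N^2$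 elements $d_i^j$, $1\le i,j\le N$, with $d_i^jd_k^l=-d_k^ld_i^j$. *)

theory Defs
  imports Complex_Main "HOL-Algebra.QuotRing" "HOL-Algebra.Module" "HOL-Library.Poly_Mapping"
begin

section \<open>Complex vector spaces and algebras as records\<close>

text \<open>
  Vector spaces and algebras over the complex numbers are records of type
  \<open>(complex, 'a) module\<close>.  This record type extends \<open>'a ring\<close>, so an algebra keeps its
  multiplication and unit in the ring part; for a mere vector space those two fields carry no
  meaning.
\<close>

definition scale :: "complex \<Rightarrow> ('k \<Rightarrow>\<^sub>0 complex) \<Rightarrow> 'k \<Rightarrow>\<^sub>0 complex"
  where "scale c p = Poly_Mapping.map ((*) c) p"

definition free_space :: "'k set \<Rightarrow> (complex, 'k \<Rightarrow>\<^sub>0 complex) module"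
  where "free_space S =
    \<lparr>carrier = {p. Poly_Mapping.keys p \<subseteq> S}, monoid.mult = undefined, one = undefined,
     zero = 0, add = (+), smult = scale\<rparr>"

definition monoid_algebra :: "(complex, 'k::monoid_add \<Rightarrow>\<^sub>0 complex) module"
  where "monoid_algebra = (free_space UNIV)\<lparr>monoid.mult := (*), one := 1\<rparr>"

text \<open>
  The library's quotient ring \<open>M Quot K\<close>, with the induced scalar multiplication.  It is used
  both for an algebra modulo an ideal and for a vector space modulo a subspace; in the latter
  case only its additive part is meaningful.
\<close>

definition quotient_module :: "(complex, 'a) module \<Rightarrow> 'a set \<Rightarrow> (complex, 'a set) module"
  where "quotient_module M K =
    ring.extend (M Quot K)
      (module.fields (\<lambda>c X. \<Union>x\<in>X. K +>\<^bsub>M\<^esub> (c \<odot>\<^bsub>M\<^esub> x)))"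

definition linear_map ::
    "(complex, 'a) module \<Rightarrow> (complex, 'b) module \<Rightarrow> ('a \<Rightarrow> 'b) \<Rightarrow> bool"
  where "linear_map M M' f \<longleftrightarrow>
    f \<in> carrier M \<rightarrow> carrier M' \<and>
    (\<forall>x\<in>carrier M. \<forall>y\<in>carrier M. f (x \<oplus>\<^bsub>M\<^esub> y) = f x \<oplus>\<^bsub>M'\<^esub> f y) \<and>
    (\<forall>c. \<forall>x\<in>carrier M. f (c \<odot>\<^bsub>M\<^esub> x) = c \<odot>\<^bsub>M'\<^esub> f x)"


section \<open>Tensor products\<close>

definition tensor_relations ::
    "(complex, 'a) module \<Rightarrow> (complex, 'b) module \<Rightarrow> ('a \<times> 'b \<Rightarrow>\<^sub>0 complex) set"
  where "tensor_relations M N =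
    (let e = (\<lambda>x y. Poly_Mapping.single (x, y) 1) in
      {e (x \<oplus>\<^bsub>M\<^esub> x') y - e x y - e x' y | x x' y.
         x \<in> carrier M \<and> x' \<in> carrier M \<and> y \<in> carrier N} \<union>
      {e x (y \<oplus>\<^bsub>N\<^esub> y') - e x y - e x y' | x y y'.
         x \<in> carrier M \<and> y \<in> carrier N \<and> y' \<in> carrier N} \<union>
      {e (c \<odot>\<^bsub>M\<^esub> x) y - scale c (e x y) | c x y. x \<in> carrier M \<and> y \<in> carrier N} \<union>
      {e x (c \<odot>\<^bsub>N\<^esub> y) - scale c (e x y) | c x y. x \<in> carrier M \<and> y \<in> carrier N})"

definition tensor_null ::
    "(complex, 'a) module \<Rightarrow> (complex, 'b) module \<Rightarrow> ('a \<times> 'b \<Rightarrow>\<^sub>0 complex) set"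
  where "tensor_null M N = Modules.module.span scale (tensor_relations M N)"

definition tensor ::
    "(complex, 'a) module \<Rightarrow> (complex, 'b) module \<Rightarrow>
      (complex, ('a \<times> 'b \<Rightarrow>\<^sub>0 complex) set) module"
  where "tensor M N = quotient_module (free_space (carrier M \<times> carrier N)) (tensor_null M N)"

definition pure_tensor ::
    "(complex, 'a) module \<Rightarrow> (complex, 'b) module \<Rightarrow> 'a \<Rightarrow> 'b \<Rightarrow>
      ('a \<times> 'b \<Rightarrow>\<^sub>0 complex) set"
  where "pure_tensor M N x y =
    tensor_null M N +>\<^bsub>free_space (carrier M \<times> carrier N)\<^esub> Poly_Mapping.single (x, y) 1"


section \<open>Algebras given by generators and relations\<close>

datatype 'x word = Word "'x list"

instantiation word :: (type) monoid_add
begin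

definition zero_word :: "'x word" where "zero_word = Word []"

fun plus_word :: "'x word \<Rightarrow> 'x word \<Rightarrow> 'x word"
  where "plus_word (Word u) (Word v) = Word (u @ v)"

instance
proof
  fix a b c :: "'x word"
  show "a + b + c = a + (b + c)" by (cases a; cases b; cases c) simp
  show "0 + a = a" by (cases a) (simp add: zero_word_def)
  show "a + 0 = a" by (cases a) (simp add: zero_word_def)
qed

end

text \<open>The free algebra is the monoid algebra of the free monoid of words.\<close>

type_synonym 'x free_algebra = "'x word \<Rightarrow>\<^sub>0 complex"

definition var :: "'x \<Rightarrow> 'x free_algebra"
  where "var x = Poly_Mapping.single (Word [x]) 1"

lemma ring_monoid_algebra: "ring (monoid_algebra :: (complex, 'k::monoid_add \<Rightarrow>\<^sub>0 complex) module)"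
  (is "ring ?A")
proof (rule ringI)
  show "abelian_group ?A"
  proof (rule abelian_groupI)
    fix x assume "x \<in> carrier ?A"
    show "\<exists>y\<in>carrier ?A. y \<oplus>\<^bsub>?A\<^esub> x = \<zero>\<^bsub>?A\<^esub>"
      by (rule bexI[of _ "- x"]) (simp_all add: monoid_algebra_def free_space_def)
  qed (simp_all add: monoid_algebra_def free_space_def add_ac)
  show "Group.monoid ?A"
    by (rule Group.monoidI) (simp_all add: monoid_algebra_def free_space_def mult.assoc)
qed (simp_all add: monoid_algebra_def free_space_def ring_distribs)

definition relation_ideal :: "'x free_algebra set \<Rightarrow> 'x free_algebra set"
  where "relation_ideal R = Idl\<^bsub>monoid_algebra\<^esub> R"

definition presented_algebra :: "'x free_algebra set \<Rightarrow> (complex, 'x free_algebra set) module"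
  where "presented_algebra R = quotient_module monoid_algebra (relation_ideal R)"

definition generator :: "'x free_algebra set \<Rightarrow> 'x \<Rightarrow> 'x free_algebra set"
  where "generator R x = relation_ideal R +>\<^bsub>monoid_algebra\<^esub> var x"


section \<open>The enveloping algebra and the exterior algebra\<close>

text \<open>
  The index set $\{1, \dots, N\}$ is a nonempty finite type \<open>'n\<close>.  The generator with lower
  index $i$ and upper index $j$ corresponds to the pair \<open>(i, j)\<close>.
\<close>

type_synonym 'n alg_elem = "('n \<times> 'n) free_algebra set"

definition delta :: "'n \<Rightarrow> 'n \<Rightarrow> complex"
  where "delta i j = (if i = j then 1 else 0)"

definition U_relations :: "complex \<Rightarrow> ('n \<times> 'n) free_algebra set"
  where "U_relations h =
    {var (i, j) * var (k, l) - var (k, l) * var (i, j)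
       - scale h (scale (delta k j) (var (i, l)) - scale (delta i l) (var (k, j)))
     | i j k l. True}"

definition U_gl :: "complex \<Rightarrow> (complex, 'n alg_elem) module"
  where "U_gl h = presented_algebra (U_relations h)"

definition mgen :: "complex \<Rightarrow> 'n \<Rightarrow> 'n \<Rightarrow> 'n alg_elem"
  where "mgen h i j = generator (U_relations h) (i, j)"

definition Omega_relations :: "('n \<times> 'n) free_algebra set"
  where "Omega_relations =
    {var (i, j) * var (k, l) + var (k, l) * var (i, j) | i j k l. True}"

definition Omega_gl :: "(complex, 'n alg_elem) module"
  where "Omega_gl = presented_algebra Omega_relations"

definition dgen :: "'n \<Rightarrow> 'n \<Rightarrow> 'n alg_elem"
  where "dgen i j = generator Omega_relations (i, j)"


section \<open>Quantum partial derivatives\<close>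

text \<open>
  The algebra of quantum partial derivatives is the polynomial algebra in the commuting
  variables $\partial_i^j$.
\<close>

type_synonym 'n diff_algebra = "('n \<times> 'n \<Rightarrow>\<^sub>0 nat) \<Rightarrow>\<^sub>0 complex"

definition pdiff :: "'n \<Rightarrow> 'n \<Rightarrow> 'n diff_algebra"
  where "pdiff i j = Poly_Mapping.single (Poly_Mapping.single (i, j) 1) 1"

locale quantum_derivatives =
  fixes h :: complex
    and act :: "'n::finite diff_algebra \<Rightarrow> 'n alg_elem \<Rightarrow> 'n alg_elem"
  assumes act_linear: "linear_map (U_gl h) (U_gl h) (act p)"
    and act_add: "a \<in> carrier (U_gl h) \<Longrightarrow> act (p + q) a = act p a \<oplus>\<^bsub>U_gl h\<^esub> act q a"
    and act_scale: "a \<in> carrier (U_gl h) \<Longrightarrow> act (scale c p) a = c \<odot>\<^bsub>U_gl h\<^esub> act p a"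
    and act_mult: "a \<in> carrier (U_gl h) \<Longrightarrow> act (p * q) a = act p (act q a)"
    and act_one: "a \<in> carrier (U_gl h) \<Longrightarrow> act 1 a = a"
    and pdiff_unit: "act (pdiff i j) \<one>\<^bsub>U_gl h\<^esub> = \<zero>\<^bsub>U_gl h\<^esub>"
    and pdiff_generator:
      "act (pdiff i j) (mgen h k l) = (delta i l * delta k j) \<odot>\<^bsub>U_gl h\<^esub> \<one>\<^bsub>U_gl h\<^esub>"
    and quantum_Leibniz:
      "\<lbrakk>a \<in> carrier (U_gl h); b \<in> carrier (U_gl h)\<rbrakk> \<Longrightarrow>
        act (pdiff i j) (a \<otimes>\<^bsub>U_gl h\<^esub> b) =
          act (pdiff i j) a \<otimes>\<^bsub>U_gl h\<^esub> b
          \<oplus>\<^bsub>U_gl h\<^esub> a \<otimes>\<^bsub>U_gl h\<^esub> act (pdiff i j) b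
          \<oplus>\<^bsub>U_gl h\<^esub> h \<odot>\<^bsub>U_gl h\<^esub>
            (\<Oplus>\<^bsub>U_gl h\<^esub>k\<in>UNIV. act (pdiff k j) a \<otimes>\<^bsub>U_gl h\<^esub> act (pdiff i k) b)"


section \<open>The de Rham operator\<close>

type_synonym 'n form = "('n alg_elem \<times> 'n alg_elem \<Rightarrow>\<^sub>0 complex) set"

definition forms :: "complex \<Rightarrow> (complex, 'n form) module"
  where "forms h = tensor Omega_gl (U_gl h)"

definition de_Rham_operator ::
    "complex \<Rightarrow>
     ('n::finite diff_algebra \<Rightarrow> 'n alg_elem \<Rightarrow> 'n alg_elem) \<Rightarrow>
     ('n form \<Rightarrow> 'n form) \<Rightarrow> bool"
  where "de_Rham_operator h act d \<longleftrightarrow>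
    linear_map (forms h) (forms h) d \<and>
    (\<forall>\<omega>\<in>carrier Omega_gl. \<forall>a\<in>carrier (U_gl h).
      d (pure_tensor Omega_gl (U_gl h) \<omega> a) =
        (\<Oplus>\<^bsub>forms h\<^esub>i\<in>UNIV. \<Oplus>\<^bsub>forms h\<^esub>j\<in>UNIV.
          pure_tensor Omega_gl (U_gl h) (\<omega> \<otimes>\<^bsub>Omega_gl\<^esub> dgen i j) (act (pdiff j i) a)))"

end

theory Submission
  imports Defs
begin

text \<open>
  On a pure tensor, $\mathbf{d}^2(\omega \otimes a)$ is a double sum of the terms
  $\omega\, d_y d_z \otimes \partial_z \partial_y a$ over pairs of indices $y, z$.  The
  derivatives commute and the $d_z$ anticommute, so swapping $y$ and $z$ changes the sign of a
  term; twice the sum therefore vanishes, and so does the sum.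
\<close>

section \<open>Quotients of free vector spaces\<close>

lemma lookup_scale: "Poly_Mapping.lookup (scale c p) k = c * Poly_Mapping.lookup p k"
  by (simp add: scale_def Poly_Mapping.map.rep_eq when_def)

lemma scale_module: "Modules.module scale"
  by unfold_locales
    (simp_all add: poly_mapping_eq_iff fun_eq_iff lookup_scale Poly_Mapping.lookup_add algebra_simps)

interpretation free: Modules.module scale
  by (rule scale_module)

lemma keys_scale_subset: "Poly_Mapping.keys (scale c p) \<subseteq> Poly_Mapping.keys p"
  by (auto simp: in_keys_iff lookup_scale)

lemma abelian_group_free_space: "abelian_group (free_space S)"
proof (rule abelian_groupI)
  fix x y assume "x \<in> carrier (free_space S)" "y \<in> carrier (free_space S)"
  then show "x \<oplus>\<^bsub>free_space S\<^esub> y \<in> carrier (free_space S)"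
    using Poly_Mapping.keys_add[of x y] by (auto simp: free_space_def)
next
  fix x assume "x \<in> carrier (free_space S)"
  then show "\<exists>y\<in>carrier (free_space S). y \<oplus>\<^bsub>free_space S\<^esub> x = \<zero>\<^bsub>free_space S\<^esub>"
    by (intro bexI[of _ "- x"]) (simp_all add: free_space_def)
qed (simp_all add: free_space_def add_ac)

lemma quotient_module_simps:
  "carrier (quotient_module M K) = carrier (M Quot K)"
  "monoid.mult (quotient_module M K) = monoid.mult (M Quot K)"
  "one (quotient_module M K) = one (M Quot K)"
  "zero (quotient_module M K) = zero (M Quot K)"
  "add (quotient_module M K) = add (M Quot K)"
  "smult (quotient_module M K) c X = (\<Union>x\<in>X. K +>\<^bsub>M\<^esub> (c \<odot>\<^bsub>M\<^esub> x))"
  by (simp_all add: quotient_module_def ring.defs module.defs)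

text \<open>\<open>quotient_module M K\<close> has the operations of \<open>M Quot K\<close> but
  lives in a larger record type, so the axioms are checked again field by field; likewise for rings
  below.\<close>

lemma abelian_group_quotient_module:
  assumes "abelian_group (M Quot K)"
  shows "abelian_group (quotient_module M K)"
proof -
  interpret Q: abelian_group "M Quot K" by fact
  show ?thesis
  proof (rule abelian_groupI)
    fix x assume "x \<in> carrier (quotient_module M K)"
    then show "\<exists>y\<in>carrier (quotient_module M K).
        y \<oplus>\<^bsub>quotient_module M K\<^esub> x = \<zero>\<^bsub>quotient_module M K\<^esub>"
      using Q.l_neg Q.a_inv_closed unfolding quotient_module_simps by blast
  qed (simp_all add: quotient_module_simps Q.a_ac)
qed

lemma ring_quotient_module:
  assumes "ideal K M"
  shows "ring (quotient_module M K)"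
proof -
  interpret Q: ring "M Quot K"
    by (rule ideal.quotient_is_ring[OF assms])
  show ?thesis
  proof (rule ringI)
    show "abelian_group (quotient_module M K)"
      by (rule abelian_group_quotient_module[OF Q.is_abelian_group])
    show "Group.monoid (quotient_module M K)"
      by (rule Group.monoidI) (simp_all add: quotient_module_simps Q.m_assoc)
  qed (simp_all add: quotient_module_simps Q.l_distr Q.r_distr)
qed

text \<open>Common frame for the two quotients in play: tensor products (\<open>S\<close> the
  product of the carriers) and presented algebras (\<open>S\<close> all words).
  \<open>K_keys\<close> places \<open>K\<close> inside the carrier of
  \<open>free_space S\<close>.\<close>

locale free_quotient =
  fixes S :: "'k set" and K :: "('k \<Rightarrow>\<^sub>0 complex) set"
  assumes K_subspace: "free.subspace K"
    and K_keys: "p \<in> K \<Longrightarrow> Poly_Mapping.keys p \<subseteq> S"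
begin

abbreviation coset :: "('k \<Rightarrow>\<^sub>0 complex) \<Rightarrow> ('k \<Rightarrow>\<^sub>0 complex) set"
  where "coset p \<equiv> K +>\<^bsub>free_space S\<^esub> p"

abbreviation Q where "Q \<equiv> quotient_module (free_space S) K"

lemma coset_eq: "coset p = (\<lambda>k. k + p) ` K"
  by (auto simp: a_r_coset_def' free_space_def)

lemma coset_eq_iff: "coset p = coset q \<longleftrightarrow> p - q \<in> K"
proof
  assume "coset p = coset q"
  moreover have "p \<in> coset p"
    using free.subspace_0[OF K_subspace] by (force simp: coset_eq)
  ultimately show "p - q \<in> K"
    by (auto simp: coset_eq)
next
  assume *: "p - q \<in> K"
  have "k + p \<in> coset q" if "k \<in> K" for k
    unfolding coset_eq
    by (rule image_eqI[of _ _ "k + (p - q)"])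
      (use free.subspace_add[OF K_subspace that *] in simp_all)
  moreover have "k + q \<in> coset p" if "k \<in> K" for k
    unfolding coset_eq
    by (rule image_eqI[of _ _ "k - (p - q)"])
      (use free.subspace_diff[OF K_subspace that *] in simp_all)
  ultimately show "coset p = coset q"
    by (auto simp: coset_eq)
qed

lemma coset_0: "coset 0 = K"
  by (simp add: coset_eq)

sublocale abelian_subgroup K "free_space S"
proof -
  interpret F: abelian_group "free_space S"
    by (rule abelian_group_free_space)
  have minus: "\<ominus>\<^bsub>free_space S\<^esub> p = - p" if "p \<in> K" for p
    by (rule F.minus_equality) (use K_keys[OF that] in \<open>simp_all add: free_space_def\<close>)
  have "subgroup K (add_monoid (free_space S))"
  proof (rule F.add.subgroupI)
    show "K \<subseteq> carrier (free_space S)"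
      using K_keys by (auto simp: free_space_def)
    show "K \<noteq> {}"
      using free.subspace_0[OF K_subspace] by auto
  qed (use free.subspace_add[OF K_subspace] free.subspace_neg[OF K_subspace]
        in \<open>simp_all add: minus, simp add: free_space_def\<close>)
  then show "abelian_subgroup K (free_space S)"
    by (intro abelian_subgroupI3 additive_subgroupI abelian_group_free_space)
qed

lemma carrier_Q: "carrier Q = coset ` {p. Poly_Mapping.keys p \<subseteq> S}"
  by (auto simp: quotient_module_simps FactRing_def A_RCOSETS_def' free_space_def)

lemma zero_Q: "\<zero>\<^bsub>Q\<^esub> = coset 0"
  by (simp add: coset_0 quotient_module_simps FactRing_def)

lemma add_Q:
  assumes "Poly_Mapping.keys p \<subseteq> S" "Poly_Mapping.keys q \<subseteq> S"
  shows "coset p \<oplus>\<^bsub>Q\<^esub> coset q = coset (p + q)"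
  using a_rcos_sum[of p q] assms
  by (simp add: quotient_module_simps FactRing_def) (simp add: free_space_def)

text \<open>Scaling in the quotient is a union over all representatives of a coset. They all yield
  the same coset because \<open>K\<close> is closed under scaling, so the nonempty union
  collapses.\<close>

lemma smult_Q: "c \<odot>\<^bsub>Q\<^esub> coset p = coset (scale c p)"
proof -
  have "coset (scale c (k + p)) = coset (scale c p)" if "k \<in> K" for k
    using free.subspace_scale[OF K_subspace that]
    by (simp add: coset_eq_iff free.scale_right_distrib)
  moreover have "K \<noteq> {}"
    using free.subspace_0[OF K_subspace] by auto
  moreover have "c \<odot>\<^bsub>free_space S\<^esub> x = scale c x" for x
    by (simp add: free_space_def)
  ultimately show ?thesis
    unfolding quotient_module_simps by (simp add: coset_eq[of p])
qed

text \<open>The multiplication of \<open>free_space S\<close> is \<open>undefined\<close>, so the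
  argument stays additive: the quotient is the factor group of an abelian group by a
  subgroup.\<close>

lemma abelian_group_Q: "abelian_group Q"
  by (intro abelian_group_quotient_module comm_group_abelian_groupI)
    (simp add: FactRing_def a_factorgroup_is_comm_group[unfolded A_FactGroup_def'])

text \<open>Scaling \<open>p + p\<close> by 1/2 gives back \<open>p\<close> without leaving
  \<open>K\<close>. Here the characteristic of the ground field, different from 2, enters.\<close>

lemma double_eq_zero_Q:
  assumes "x \<in> carrier Q" "x \<oplus>\<^bsub>Q\<^esub> x = \<zero>\<^bsub>Q\<^esub>"
  shows "x = \<zero>\<^bsub>Q\<^esub>"
proof -
  obtain p where p: "x = coset p" "Poly_Mapping.keys p \<subseteq> S"
    using assms(1) by (auto simp: carrier_Q)
  have "p + p \<in> K"
    using assms(2) by (simp add: p add_Q zero_Q coset_eq_iff)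
  from free.subspace_scale[OF K_subspace this, of "1/2"] have "p \<in> K"
    by (simp add: free.scale_right_distrib flip: free.scale_left_distrib)
  then show ?thesis
    by (simp add: p zero_Q coset_eq_iff)
qed

text \<open>Every element is a finite linear combination of basis cosets. For tensor products these
  are the pure tensors, so a linear identity need only be checked there.\<close>

lemma induct_Q [consumes 1, case_names basis smult add zero]:
  assumes "x \<in> carrier Q"
    and basis: "\<And>k. k \<in> S \<Longrightarrow> P (coset (Poly_Mapping.single k 1))"
    and smult: "\<And>c y. y \<in> carrier Q \<Longrightarrow> P y \<Longrightarrow> P (c \<odot>\<^bsub>Q\<^esub> y)"
    and add: "\<And>y z. y \<in> carrier Q \<Longrightarrow> z \<in> carrier Q \<Longrightarrow> P y \<Longrightarrow> P z \<Longrightarrow> P (y \<oplus>\<^bsub>Q\<^esub> z)"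
    and zero: "P \<zero>\<^bsub>Q\<^esub>"
  shows "P x"
proof -
  \<comment> \<open>\<open>A\<close> only has to contain the support of \<open>p\<close>: a
    coefficient at a point of \<open>A\<close> may be zero, and \<open>p\<close> must vary when a
    term is removed.\<close>
  have *: "P (coset p)" if "finite A" "A \<subseteq> S" "Poly_Mapping.keys p \<subseteq> A" for A p
    using that
  proof (induction A arbitrary: p rule: finite_induct)
    case empty
    then show ?case
      using zero by (simp add: zero_Q)
  next
    case (insert a A)
    let ?s = "Poly_Mapping.single a 1 :: 'k \<Rightarrow>\<^sub>0 complex"
    \<comment> \<open>Subtracting the term of \<open>p\<close> at \<open>a\<close> removes
      \<open>a\<close> from the support, so the induction hypothesis applies to the
      remainder.\<close>
    define q where "q = p - scale (Poly_Mapping.lookup p a) ?s"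
    have "Poly_Mapping.keys q \<subseteq> A"
    proof
      fix k assume k: "k \<in> Poly_Mapping.keys q"
      then have "k \<noteq> a"
        by (auto simp: in_keys_iff q_def lookup_scale Poly_Mapping.lookup_minus)
      with k have "k \<in> Poly_Mapping.keys p"
        by (simp add: in_keys_iff q_def lookup_scale Poly_Mapping.lookup_minus
            Poly_Mapping.lookup_single)
      with \<open>k \<noteq> a\<close> insert.prems show "k \<in> A"
        by auto
    qed
    with insert have q: "Poly_Mapping.keys q \<subseteq> S" "P (coset q)"
      by auto
    have s: "Poly_Mapping.keys ?s \<subseteq> S"
      using insert.prems by simp
    then have "coset ?s \<in> carrier Q"
      by (simp add: carrier_Q)
    then have cs: "P (coset (scale c ?s))" for c
      using basis[of a] smult insert.prems by (simp flip: smult_Q)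
    have ss: "Poly_Mapping.keys (scale c ?s) \<subseteq> S" for c
      using keys_scale_subset s by (rule order_trans)
    have "coset q \<in> carrier Q" "coset (scale c ?s) \<in> carrier Q" for c
      using q(1) ss by (simp_all add: carrier_Q)
    from add[OF this q(2) cs] have "P (coset (q + scale c ?s))" for c
      by (simp add: add_Q q(1) ss)
    from this[of "Poly_Mapping.lookup p a"] show ?case
      by (simp add: q_def)
  qed
  obtain p where "x = coset p" "Poly_Mapping.keys p \<subseteq> S"
    using assms(1) by (auto simp: carrier_Q)
  with *[OF finite_keys _ order_refl] show ?thesis
    by simp
qed

end


section \<open>Tensor products\<close>

text \<open>The span is taken among all finitely supported functions on pairs. Each relation is
  supported on the product of the carriers, by the closure assumptions, and such functions form a
  subspace, which therefore contains the span.\<close>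

lemma free_quotient_tensor:
  assumes "abelian_group M" "abelian_group N"
    and "\<And>c x. x \<in> carrier M \<Longrightarrow> c \<odot>\<^bsub>M\<^esub> x \<in> carrier M"
    and "\<And>c y. y \<in> carrier N \<Longrightarrow> c \<odot>\<^bsub>N\<^esub> y \<in> carrier N"
  shows "free_quotient (carrier M \<times> carrier N) (tensor_null M N)"
proof
  interpret M: abelian_group M by fact
  interpret N: abelian_group N by fact
  let ?F = "{p :: _ \<Rightarrow>\<^sub>0 complex. Poly_Mapping.keys p \<subseteq> carrier M \<times> carrier N}"
  show "free.subspace (tensor_null M N)"
    by (simp add: tensor_null_def)
  have F: "free.subspace ?F"
    using Poly_Mapping.keys_add keys_scale_subset
    by (fastforce intro!: free.subspaceI)
  have single: "Poly_Mapping.single z 1 \<in> ?F" if "z \<in> carrier M \<times> carrier N" for z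
    using that by simp
  have "tensor_relations M N \<subseteq> ?F"
    unfolding tensor_relations_def Let_def
    by (intro Un_least subsetI; elim CollectE exE conjE; simp only:;
        intro free.subspace_diff[OF F] free.subspace_scale[OF F] single)
      (simp_all add: assms)
  from free.span_minimal[OF this F] show "Poly_Mapping.keys p \<subseteq> carrier M \<times> carrier N"
    if "p \<in> tensor_null M N" for p
    using that by (auto simp: tensor_null_def)
qed

lemma pure_tensor_closed:
  assumes "free_quotient (carrier M \<times> carrier N) (tensor_null M N)"
    and "x \<in> carrier M" "y \<in> carrier N"
  shows "pure_tensor M N x y \<in> carrier (tensor M N)"
  using assms(2,3)
  by (simp add: pure_tensor_def tensor_def free_quotient.carrier_Q[OF assms(1)])

text \<open>The difference of the two sides is itself a defining relation. Additivity in the left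
  factor later merges two terms that share their right factor.\<close>

lemma pure_tensor_add_left:
  assumes "free_quotient (carrier M \<times> carrier N) (tensor_null M N)"
    and "x \<in> carrier M" "x' \<in> carrier M" "y \<in> carrier N"
  shows "pure_tensor M N (x \<oplus>\<^bsub>M\<^esub> x') y = pure_tensor M N x y \<oplus>\<^bsub>tensor M N\<^esub> pure_tensor M N x' y"
proof -
  interpret T: free_quotient "carrier M \<times> carrier N" "tensor_null M N"
    by fact
  let ?e = "\<lambda>x. Poly_Mapping.single (x, y) 1 :: _ \<Rightarrow>\<^sub>0 complex"
  have "?e (x \<oplus>\<^bsub>M\<^esub> x') - ?e x - ?e x' \<in> tensor_relations M N"
    using assms(2-4) unfolding tensor_relations_def Let_def by blast
  then have "?e (x \<oplus>\<^bsub>M\<^esub> x') - (?e x + ?e x') \<in> tensor_null M N"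
    unfolding tensor_null_def by (simp add: free.span_base diff_diff_eq)
  with assms(2-4) show ?thesis
    by (simp add: pure_tensor_def tensor_def T.add_Q T.coset_eq_iff)
qed


section \<open>Finite sums in abelian groups\<close>

text \<open>Serves twice: to merge an index pair into one index, and to swap the indices of a double
  sum by reindexing the product.\<close>

lemma (in abelian_monoid) finsum_Times:
  assumes "finite A" "finite B" "\<And>x y. x \<in> A \<Longrightarrow> y \<in> B \<Longrightarrow> f x y \<in> carrier G"
  shows "(\<Oplus>x\<in>A. \<Oplus>y\<in>B. f x y) = (\<Oplus>z\<in>A \<times> B. f (fst z) (snd z))"
  using assms(1,3)
proof (induction A rule: finite_induct)
  case (insert a A)
  have "(\<Oplus>z\<in>{a} \<times> B. f (fst z) (snd z)) = (\<Oplus>z\<in>Pair a ` B. f (fst z) (snd z))"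
    by (rule finsum_cong') (use insert.prems in auto)
  also have "\<dots> = (\<Oplus>y\<in>B. f a y)"
    by (subst finsum_reindex) (use insert.prems in \<open>auto simp: inj_on_def\<close>)
  finally have a: "(\<Oplus>z\<in>{a} \<times> B. f (fst z) (snd z)) = (\<Oplus>y\<in>B. f a y)" .
  have "(\<Oplus>z\<in>insert a A \<times> B. f (fst z) (snd z)) =
      (\<Oplus>z\<in>({a} \<times> B) \<union> (A \<times> B). f (fst z) (snd z))"
    by (rule finsum_cong') (use insert.prems in auto)
  also have "\<dots> = (\<Oplus>z\<in>{a} \<times> B. f (fst z) (snd z)) \<oplus> (\<Oplus>z\<in>A \<times> B. f (fst z) (snd z))"
    by (rule finsum_Un_disjoint) (use insert assms(2) in auto)
  also have "\<dots> = (\<Oplus>x\<in>insert a A. \<Oplus>y\<in>B. f x y)"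
    unfolding a using insert by (subst finsum_insert) (auto intro!: finsum_closed)
  finally show ?case ..
qed simp

text \<open>The sum equals its transpose, and adding the two termwise gives zeros. In a general
  abelian group 2-torsion may remain, hence the doubled sum; \<open>double_eq_zero_Q\<close> removes
  the factor 2 afterwards.\<close>

lemma (in abelian_group) finsum_alternating:
  assumes "finite A" "\<And>x y. x \<in> A \<Longrightarrow> y \<in> A \<Longrightarrow> f x y \<in> carrier G"
    and "\<And>x y. x \<in> A \<Longrightarrow> y \<in> A \<Longrightarrow> f x y \<oplus> f y x = \<zero>"
  shows "(\<Oplus>x\<in>A. \<Oplus>y\<in>A. f x y) \<oplus> (\<Oplus>x\<in>A. \<Oplus>y\<in>A. f x y) = \<zero>"
proof -
  have "(\<Oplus>z\<in>A \<times> A. f (fst z) (snd z)) = (\<Oplus>z\<in>prod.swap ` (A \<times> A). f (fst z) (snd z))"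
    by (simp add: product_swap)
  also have "\<dots> = (\<Oplus>z\<in>A \<times> A. f (snd z) (fst z))"
    by (subst finsum_reindex) (use assms(2) in auto)
  finally have swap: "(\<Oplus>z\<in>A \<times> A. f (fst z) (snd z)) = (\<Oplus>z\<in>A \<times> A. f (snd z) (fst z))" .
  have "(\<Oplus>z\<in>A \<times> A. f (fst z) (snd z)) \<oplus> (\<Oplus>z\<in>A \<times> A. f (snd z) (fst z)) =
      (\<Oplus>z\<in>A \<times> A. f (fst z) (snd z) \<oplus> f (snd z) (fst z))"
    by (rule finsum_addf[symmetric]) (use assms(2) in auto)
  also have "\<dots> = (\<Oplus>z\<in>A \<times> A. \<zero>)"
    by (rule finsum_cong') (use assms(3) in auto)
  finally show ?thesis
    using finsum_Times[OF assms(1,1,2)] swap by simp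
qed

lemma additive_finsum:
  assumes "abelian_group G" "abelian_group H" "\<phi> \<in> carrier G \<rightarrow> carrier H"
    and add: "\<And>x y. x \<in> carrier G \<Longrightarrow> y \<in> carrier G \<Longrightarrow> \<phi> (x \<oplus>\<^bsub>G\<^esub> y) = \<phi> x \<oplus>\<^bsub>H\<^esub> \<phi> y"
    and "finite A" "f \<in> A \<rightarrow> carrier G"
  shows "\<phi> (finsum G f A) = finsum H (\<lambda>x. \<phi> (f x)) A"
proof -
  interpret G: abelian_group G by fact
  interpret H: abelian_group H by fact
  have "\<phi> \<zero>\<^bsub>G\<^esub> \<in> carrier H"
    using assms(3) by (auto simp: Pi_iff)
  \<comment> \<open>The image of zero satisfies x + x = x, so cancellation makes it zero.\<close>
  then have zero: "\<phi> \<zero>\<^bsub>G\<^esub> = \<zero>\<^bsub>H\<^esub>"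
    using add[of "\<zero>\<^bsub>G\<^esub>" "\<zero>\<^bsub>G\<^esub>"] H.add.l_cancel_one'[of "\<phi> \<zero>\<^bsub>G\<^esub>" "\<phi> \<zero>\<^bsub>G\<^esub>"] by simp
  show ?thesis
    using assms(5,6)
  proof (induction A rule: finite_induct)
    case empty
    show ?case by (simp add: zero)
  next
    case (insert a A)
    then show ?case
      using assms(3)
      by (simp add: G.finsum_insert H.finsum_insert add Pi_iff)
  qed
qed


section \<open>Presented algebras\<close>

lemma relation_ideal_ideal: "ideal (relation_ideal R) monoid_algebra"
  unfolding relation_ideal_def
  by (rule ring.genideal_ideal[OF ring_monoid_algebra]) (simp add: monoid_algebra_def free_space_def)

lemma ring_presented_algebra: "ring (presented_algebra R)"
  unfolding presented_algebra_def by (rule ring_quotient_module[OF relation_ideal_ideal])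

text \<open>An ideal of the free algebra is a subspace because scaling by \<open>c\<close> is
  multiplication by \<open>c\<close> times the empty word.\<close>

lemma free_quotient_relation_ideal: "free_quotient UNIV (relation_ideal R)"
proof
  interpret ideal "relation_ideal R" monoid_algebra
    by (rule relation_ideal_ideal)
  have "scale c p \<in> relation_ideal R" if "p \<in> relation_ideal R" for c p
    using I_l_closed[OF that, of "Poly_Mapping.single 0 c"]
    by (simp add: monoid_algebra_def free_space_def scale_def mult_map_scale_conv_mult)
  moreover have "0 \<in> relation_ideal R"
    using additive_subgroup.zero_closed[OF is_additive_subgroup]
    by (simp add: monoid_algebra_def free_space_def)
  moreover have "p + q \<in> relation_ideal R"
    if "p \<in> relation_ideal R" "q \<in> relation_ideal R" for p q
    using additive_subgroup.a_closed[OF is_additive_subgroup that]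
    by (simp add: monoid_algebra_def free_space_def)
  ultimately show "free.subspace (relation_ideal R)"
    by (intro free.subspaceI)
qed simp

lemma smult_closed_presented_algebra:
  assumes "x \<in> carrier (presented_algebra R)"
  shows "c \<odot>\<^bsub>presented_algebra R\<^esub> x \<in> carrier (presented_algebra R)"
proof -
  interpret P: free_quotient UNIV "relation_ideal R"
    by (rule free_quotient_relation_ideal)
  \<comment> \<open>\<open>monoid_algebra\<close> differs from \<open>free_space UNIV\<close> only
    in product and unit, so both have the same additive cosets.\<close>
  have coset: "relation_ideal R +>\<^bsub>monoid_algebra\<^esub> p = P.coset p" for p
    by (simp add: a_r_coset_def' monoid_algebra_def free_space_def)
  have "carrier (presented_algebra R) = carrier P.Q"
    "c \<odot>\<^bsub>presented_algebra R\<^esub> x = c \<odot>\<^bsub>P.Q\<^esub> x"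
    unfolding presented_algebra_def quotient_module_simps FactRing_def A_RCOSETS_def'
    by (simp_all add: coset) (simp_all add: monoid_algebra_def free_space_def)
  with assms show ?thesis
    by (auto simp: P.carrier_Q P.smult_Q)
qed

lemma generator_closed: "generator R x \<in> carrier (presented_algebra R)"
  by (auto simp: generator_def presented_algebra_def quotient_module_simps FactRing_def
      A_RCOSETS_def' monoid_algebra_def free_space_def)


section \<open>The de Rham operator\<close>

lemma free_quotient_forms:
  "free_quotient (carrier (Omega_gl :: (complex, 'n alg_elem) module) \<times> carrier (U_gl h))
    (tensor_null Omega_gl (U_gl h :: (complex, 'n alg_elem) module))"
  unfolding Omega_gl_def U_gl_def
  by (intro free_quotient_tensor ring.is_abelian_group ring_presented_algebra
      smult_closed_presented_algebra)

lemma dgen_closed: "dgen i j \<in> carrier Omega_gl"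
  by (simp add: dgen_def Omega_gl_def generator_closed)

text \<open>The relation lies in the ideal, so its coset is the ideal itself, the zero of the
  quotient; the coset operations split this coset into the two products.\<close>

lemma dgen_anticommute:
  "dgen i j \<otimes>\<^bsub>Omega_gl\<^esub> dgen k l \<oplus>\<^bsub>Omega_gl\<^esub> dgen k l \<otimes>\<^bsub>Omega_gl\<^esub> dgen i j = \<zero>\<^bsub>Omega_gl\<^esub>"
proof -
  let ?I = "relation_ideal Omega_relations :: ('a \<times> 'a) free_algebra set"
  let ?A = "monoid_algebra :: (complex, ('a \<times> 'a) free_algebra) module"
  interpret I: ideal ?I ?A
    by (rule relation_ideal_ideal)
  let ?r = "var (i, j) * var (k, l) + var (k, l) * var (i, j)"
  have carrier: "p \<in> carrier ?A" for p
    by (simp add: monoid_algebra_def free_space_def)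
  have "Omega_relations \<subseteq> ?I"
    unfolding relation_ideal_def
    by (rule ring.genideal_self[OF ring_monoid_algebra]) (simp add: carrier subsetI)
  moreover have "?r \<in> Omega_relations"
    unfolding Omega_relations_def by blast
  ultimately have "?r \<in> ?I"
    by blast
  then have "?I +>\<^bsub>?A\<^esub> ?r = ?I"
    by (rule I.a_rcos_const)
  moreover have "?r = var (i, j) \<otimes>\<^bsub>?A\<^esub> var (k, l) \<oplus>\<^bsub>?A\<^esub> var (k, l) \<otimes>\<^bsub>?A\<^esub> var (i, j)"
    by (simp add: monoid_algebra_def free_space_def)
  ultimately show ?thesis
    by (simp add: dgen_def generator_def Omega_gl_def presented_algebra_def quotient_module_simps
        FactRing_def I.rcoset_mult_add I.a_rcos_sum carrier)
qed

theorem proposition4p1: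
  fixes h :: complex
    and act :: "'n::finite diff_algebra \<Rightarrow> 'n alg_elem \<Rightarrow> 'n alg_elem"
    and d :: "'n form \<Rightarrow> 'n form"
  assumes "quantum_derivatives h act"
    and "de_Rham_operator h act d"
  shows "\<forall>x\<in>carrier (forms h). d (d x) = \<zero>\<^bsub>forms h\<^esub>"
proof
  interpret quantum_derivatives h act by fact
  let ?W = "Omega_gl :: (complex, 'n alg_elem) module"
  let ?U = "U_gl h :: (complex, 'n alg_elem) module"
  let ?F = "forms h :: (complex, 'n form) module"
  let ?t = "pure_tensor ?W ?U"
  interpret T: free_quotient "carrier ?W \<times> carrier ?U" "tensor_null ?W ?U"
    by (rule free_quotient_forms)
  interpret W: ring ?W
    unfolding Omega_gl_def by (rule ring_presented_algebra)
  have Q: "T.Q = ?F"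
    by (simp add: forms_def tensor_def)
  interpret F: abelian_group ?F
    using T.abelian_group_Q unfolding Q .
  note t_closed = pure_tensor_closed[OF free_quotient_forms[where h = h], folded forms_def]
  note t_add = pure_tensor_add_left[OF free_quotient_forms[where h = h], folded forms_def]
  note [simp] = dgen_closed
  have act_closed [simp]: "act p a \<in> carrier ?U" if "a \<in> carrier ?U" for p a
    using act_linear[of p] that by (auto simp: linear_map_def)
  from assms(2) have d_closed: "d \<in> carrier ?F \<rightarrow> carrier ?F"
    and d_add: "x \<in> carrier ?F \<Longrightarrow> y \<in> carrier ?F \<Longrightarrow> d (x \<oplus>\<^bsub>?F\<^esub> y) = d x \<oplus>\<^bsub>?F\<^esub> d y"
    and d_smult: "x \<in> carrier ?F \<Longrightarrow> d (c \<odot>\<^bsub>?F\<^esub> x) = c \<odot>\<^bsub>?F\<^esub> d x" for x y c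
    by (auto simp: de_Rham_operator_def linear_map_def)
  note d_sum = additive_finsum[OF F.abelian_group_axioms F.abelian_group_axioms d_closed d_add]
  \<comment> \<open>A pair \<open>z\<close> = (i, j) serves as one index: \<open>D z\<close> is
    d_i^j and \<open>P z\<close> acts as the derivative with the indices exchanged. The fourfold sum
    for d squared thus becomes a double sum.\<close>
  define D where "D z = dgen (fst z) (snd z)" for z :: "'n \<times> 'n"
  define P where "P z = act (pdiff (snd z) (fst z))" for z :: "'n \<times> 'n"
  have [simp]: "D z \<in> carrier ?W" for z
    by (simp add: D_def)
  have [simp]: "P z a \<in> carrier ?U" if "a \<in> carrier ?U" for z a
    using that by (simp add: P_def)
  have d_pure: "d (?t w a) = (\<Oplus>\<^bsub>?F\<^esub>z\<in>UNIV. ?t (w \<otimes>\<^bsub>?W\<^esub> D z) (P z a))"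
    if "w \<in> carrier ?W" "a \<in> carrier ?U" for w a
    using assms(2) that
    by (simp add: de_Rham_operator_def F.finsum_Times t_closed D_def P_def)
  have t_zero: "?t \<zero>\<^bsub>?W\<^esub> a = \<zero>\<^bsub>?F\<^esub>" if "a \<in> carrier ?U" for a
    using t_add[of "\<zero>\<^bsub>?W\<^esub>" "\<zero>\<^bsub>?W\<^esub>" a] t_closed[of "\<zero>\<^bsub>?W\<^esub>" a] that
      F.add.l_cancel_one'[of "?t \<zero>\<^bsub>?W\<^esub> a" "?t \<zero>\<^bsub>?W\<^esub> a"]
    by simp
  have DD: "w \<otimes>\<^bsub>?W\<^esub> D y \<otimes>\<^bsub>?W\<^esub> D z \<oplus>\<^bsub>?W\<^esub> w \<otimes>\<^bsub>?W\<^esub> D z \<otimes>\<^bsub>?W\<^esub> D y = \<zero>\<^bsub>?W\<^esub>"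
    if "w \<in> carrier ?W" for w y z
    using that by (simp add: W.m_assoc D_def dgen_anticommute flip: W.r_distr)
  \<comment> \<open>\<open>act\<close> turns products into compositions, and the polynomial algebra
    of derivatives is commutative.\<close>
  have PP: "P y (P z a) = P z (P y a)" if "a \<in> carrier ?U" for y z a
    using that by (simp add: P_def mult.commute flip: act_mult)
  have dd_pure: "d (d (?t w a)) = \<zero>\<^bsub>?F\<^esub>" if "w \<in> carrier ?W" "a \<in> carrier ?U" for w a
  proof -
    \<comment> \<open>\<open>y\<close> comes from the inner application of \<open>d\<close> and
      \<open>z\<close> from the outer one.\<close>
    let ?f = "\<lambda>y z. ?t (w \<otimes>\<^bsub>?W\<^esub> D y \<otimes>\<^bsub>?W\<^esub> D z) (P z (P y a))"
    have f: "?f y z \<in> carrier ?F" for y z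
      using that by (simp add: t_closed)
    \<comment> \<open>\<open>PP\<close> makes the right factors agree, \<open>t_add\<close> joins
      the left factors, and \<open>DD\<close> makes their sum zero.\<close>
    have "?f y z \<oplus>\<^bsub>?F\<^esub> ?f z y = \<zero>\<^bsub>?F\<^esub>" for y z
      using that by (simp add: PP[of a y z] DD t_zero flip: t_add)
    with f have "(\<Oplus>\<^bsub>?F\<^esub>y\<in>UNIV. \<Oplus>\<^bsub>?F\<^esub>z\<in>UNIV. ?f y z) \<oplus>\<^bsub>?F\<^esub>
        (\<Oplus>\<^bsub>?F\<^esub>y\<in>UNIV. \<Oplus>\<^bsub>?F\<^esub>z\<in>UNIV. ?f y z) = \<zero>\<^bsub>?F\<^esub>"
      by (intro F.finsum_alternating) simp_all
    then have "(\<Oplus>\<^bsub>?F\<^esub>y\<in>UNIV. \<Oplus>\<^bsub>?F\<^esub>z\<in>UNIV. ?f y z) = \<zero>\<^bsub>?F\<^esub>"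
      by (rule T.double_eq_zero_Q[unfolded Q, rotated]) (simp add: f Pi_iff)
    moreover have "d (d (?t w a)) = (\<Oplus>\<^bsub>?F\<^esub>y\<in>UNIV. \<Oplus>\<^bsub>?F\<^esub>z\<in>UNIV. ?f y z)"
      using that by (simp add: d_pure d_sum t_closed Pi_iff)
    ultimately show ?thesis
      by simp
  qed
  have d_carrier: "d y \<in> carrier ?F" if "y \<in> carrier ?F" for y
    using d_closed that by auto
  fix x assume "x \<in> carrier ?F"
  then show "d (d x) = \<zero>\<^bsub>?F\<^esub>"
  proof (induction x rule: T.induct_Q[unfolded Q, consumes 1, case_names basis smult add zero])
    case (basis k)
    then show ?case
      using dd_pure by (auto simp: pure_tensor_def)
  next
    case (smult c y)
    \<comment> \<open>Zero is the coset of the zero function, which scaling fixes.\<close>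
    have "c \<odot>\<^bsub>?F\<^esub> \<zero>\<^bsub>?F\<^esub> = \<zero>\<^bsub>?F\<^esub>"
      using T.smult_Q[of c 0] by (simp add: T.zero_Q flip: Q)
    with smult show ?case
      by (simp add: d_smult d_carrier)
  next
    case (add y z)
    then show ?case
      by (simp add: d_add d_carrier)
  next
    case zero
    \<comment> \<open>Zero is the empty sum, and \<open>d\<close> commutes with finite sums.\<close>
    have "d \<zero>\<^bsub>?F\<^esub> = \<zero>\<^bsub>?F\<^esub>"
      using d_sum[of "{}"] by simp
    then show ?case
      by simp
  qed
qed

end
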